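(* Let $f\in R=k[x,g]/(g^p-1)$ and let $\delta=f\,\partial_x+xg\,\partial_g$ be the $k$-linear derivation of $R$ with $\delta(x)=f$, $\delta(g)=xg$. Then $$\delta^p(g)=\delta^{p-2}(f)\,g+x^pg=\delta^{p-1}(x)\,g+x^pg .$$
   Context: $p$ is an odd prime and $k$ is an algebraically closed field of characteristic $p$. $R=k[x]\otimes kG$ where $G=\langle g\rangle$ is cyclic of order $p$. *)

theory Defs
  imports "HOL-Computational_Algebra.Computational_Algebra"
begin

text \<open>
  The polynomial ring \<open>k[x,g]\<close> is \<open>k[x][g]\<close>, i.e. the type \<open>'k poly poly\<close>: the inner variable is
  \<open>x\<close>, the outer one is \<open>g\<close>. The exponent in the relation \<open>g ^ p = 1\<close> is the characteristic
  of \<open>k\<close>, so that the quotient is a type depending on \<open>'k\<close> only; it is \<open>k[x] \<otimes> kG\<close> for \<open>G\<close> cyclic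
  of order \<open>p = CHAR('k)\<close>. (For \<open>CHAR('k) = 0\<close> the relation is void, which is irrelevant here.)
\<close>

definition gp1 :: "'k::field poly poly" where
  "gp1 = monom 1 CHAR('k) - 1"

definition R_rel :: "'k::field poly poly \<Rightarrow> 'k poly poly \<Rightarrow> bool" where
  "R_rel u v \<longleftrightarrow> gp1 dvd u - v"

lemma R_rel_refl: "R_rel u u"
  by (simp add: R_rel_def)

lemma equivp_R_rel: "equivp (R_rel :: 'k::field poly poly \<Rightarrow> _)"
proof (rule equivpI)
  show "reflp (R_rel :: 'k poly poly \<Rightarrow> _)"
    by (simp add: reflp_def R_rel_refl)
  show "symp (R_rel :: 'k poly poly \<Rightarrow> _)"
    unfolding symp_def R_rel_def by (metis dvd_minus_iff minus_diff_eq)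
  show "transp (R_rel :: 'k poly poly \<Rightarrow> _)"
  proof (rule transpI)
    fix u v w :: "'k poly poly"
    assume "R_rel u v" "R_rel v w"
    then have "gp1 dvd (u - v) + (v - w)"
      unfolding R_rel_def by (rule dvd_add)
    then show "R_rel u w"
      by (simp add: R_rel_def)
  qed
qed

quotient_type (overloaded) 'k R = "'k::field poly poly" / R_rel
  by (rule equivp_R_rel)

lemma R_rel_add: "R_rel (u + v) (u' + v')" if "R_rel u u'" "R_rel v v'"
proof -
  have "gp1 dvd (u - u') + (v - v')"
    using that unfolding R_rel_def by (rule dvd_add)
  then show ?thesis
    by (simp add: R_rel_def algebra_simps)
qed

lemma R_rel_uminus: "R_rel (- u) (- u')" if "R_rel u u'"
proof -
  have "- u - - u' = - (u - u')"
    by simp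
  then show ?thesis
    using that unfolding R_rel_def by (metis dvd_minus_iff)
qed

lemma R_rel_diff: "R_rel (u - v) (u' - v')" if "R_rel u u'" "R_rel v v'"
  using R_rel_add[OF that(1) R_rel_uminus[OF that(2)]] by simp

lemma R_rel_mult: "R_rel (u * v) (u' * v')" if "R_rel u u'" "R_rel v v'"
proof -
  have "gp1 dvd (u - u') * v + u' * (v - v')"
    using that unfolding R_rel_def by (intro dvd_add dvd_mult dvd_mult2)
  then show ?thesis
    by (simp add: R_rel_def algebra_simps)
qed

lemma not_R_rel_0_1: "\<not> R_rel (0 :: 'k::field poly poly) 1"
proof
  assume "R_rel (0 :: 'k poly poly) 1"
  then have "gp1 dvd (1 :: 'k poly poly)"
    unfolding R_rel_def by simp
  then obtain h :: "'k poly poly" where "1 = gp1 * h"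
    by (elim dvdE)
  then have "poly 1 1 = poly (gp1 * h) 1"
    by simp
  then show False
    by (simp add: gp1_def poly_monom)
qed

instantiation R :: (field) comm_ring_1
begin

lift_definition zero_R :: "'a R" is 0 .
lift_definition one_R :: "'a R" is 1 .
lift_definition plus_R :: "'a R \<Rightarrow> 'a R \<Rightarrow> 'a R" is "(+)" by (rule R_rel_add)
lift_definition uminus_R :: "'a R \<Rightarrow> 'a R" is uminus by (rule R_rel_uminus)
lift_definition minus_R :: "'a R \<Rightarrow> 'a R \<Rightarrow> 'a R" is "(-)" by (rule R_rel_diff)
lift_definition times_R :: "'a R \<Rightarrow> 'a R \<Rightarrow> 'a R" is "(*)" by (rule R_rel_mult)

instance
  by standard (transfer; auto simp: algebra_simps R_rel_refl not_R_rel_0_1)+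

end

lift_definition R_const :: "'k::field \<Rightarrow> 'k R" is "\<lambda>c. [:[:c:]:]" .
lift_definition R_x :: "'k::field R" is "[:[:0, 1:]:]" .
lift_definition R_g :: "'k::field R" is "[:0, 1:]" .

lemma map_poly_pderiv_add:
  "map_poly pderiv (u + v) = map_poly pderiv u + map_poly pderiv (v :: 'k::field poly poly)"
  by (rule poly_eqI) (simp add: coeff_map_poly pderiv_add)

lemma map_poly_pderiv_diff:
  "map_poly pderiv (u - v) = map_poly pderiv u - map_poly pderiv (v :: 'k::field poly poly)"
  by (rule poly_eqI) (simp add: coeff_map_poly pderiv_diff)

lemma pderiv_sum: "pderiv (\<Sum>i\<in>A. h i) = (\<Sum>i\<in>A. pderiv (h i :: 'k::field poly))"
  by (induction A rule: infinite_finite_induct) (auto simp: pderiv_add)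

lemma map_poly_pderiv_1: "map_poly pderiv (1 :: 'k::field poly poly) = 0"
  by (rule poly_eqI) (simp add: coeff_map_poly one_pCons coeff_pCons pderiv_pCons split: nat.split)

lemma map_poly_pderiv_mult:
  "map_poly pderiv (u * v) = u * map_poly pderiv v + v * map_poly pderiv (u :: 'k::field poly poly)"
proof (rule poly_eqI)
  fix n
  have "coeff (map_poly pderiv (u * v)) n
      = (\<Sum>i\<le>n. coeff u i * pderiv (coeff v (n - i)) + pderiv (coeff u i) * coeff v (n - i))"
    by (simp add: coeff_map_poly coeff_mult pderiv_sum pderiv_mult mult.commute)
  also have "\<dots> = coeff (u * map_poly pderiv v + map_poly pderiv u * v) n"
    by (simp add: coeff_map_poly coeff_mult sum.distrib)
  finally show "coeff (map_poly pderiv (u * v)) n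
      = coeff (u * map_poly pderiv v + v * map_poly pderiv u) n"
    by (simp add: mult.commute)
qed

lemma map_poly_pderiv_gp1: "map_poly pderiv (gp1 :: 'k::field poly poly) = 0"
  by (rule poly_eqI) (auto simp: gp1_def coeff_map_poly pderiv_diff one_pCons coeff_pCons pderiv_pCons split: nat.split)

lemma pderiv_gp1: "pderiv (gp1 :: 'k::field poly poly) = 0"
  by (simp add: gp1_def pderiv_diff pderiv_monom of_nat_poly)

text \<open>Both partial derivatives of \<open>k[x,g]\<close> kill \<open>g ^ p - 1\<close> and hence descend to the quotient.\<close>

lift_definition R_dx :: "'k::field R \<Rightarrow> 'k R" is "map_poly pderiv"
  unfolding R_rel_def
  by (auto elim!: dvdE simp flip: map_poly_pderiv_diff
      simp: map_poly_pderiv_mult map_poly_pderiv_gp1)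

lift_definition R_dg :: "'k::field R \<Rightarrow> 'k R" is pderiv
  unfolding R_rel_def
  by (auto elim!: dvdE simp flip: pderiv_diff simp: pderiv_mult pderiv_gp1)

definition delta :: "'k::field R \<Rightarrow> 'k R \<Rightarrow> 'k R" where
  "delta f u = f * R_dx u + R_x * R_g * R_dg u"

definition k_derivation :: "('k::field R \<Rightarrow> 'k R) \<Rightarrow> bool" where
  "k_derivation D \<longleftrightarrow>
     (\<forall>u v. D (u + v) = D u + D v) \<and>
     (\<forall>c u. D (R_const c * u) = R_const c * D u) \<and>
     (\<forall>u v. D (u * v) = u * D v + v * D u)"

lemma R_dx_derivation: "k_derivation (R_dx :: 'k::field R \<Rightarrow> 'k R)"
  unfolding k_derivation_def
proof (intro conjI allI)
  fix u v :: "'k R" and c :: 'k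
  show "R_dx (u + v) = R_dx u + R_dx v"
    by transfer (simp add: map_poly_pderiv_add R_rel_refl)
  show mult: "R_dx (u * v) = u * R_dx v + v * R_dx u" for u v :: "'k R"
    by transfer (simp add: map_poly_pderiv_mult R_rel_refl)
  have "R_dx (R_const c) = 0"
    by transfer (simp add: map_poly_pCons R_rel_refl pderiv_pCons)
  then show "R_dx (R_const c * u) = R_const c * R_dx u"
    by (simp add: mult)
qed

lemma R_dg_derivation: "k_derivation (R_dg :: 'k::field R \<Rightarrow> 'k R)"
  unfolding k_derivation_def
proof (intro conjI allI)
  fix u v :: "'k R" and c :: 'k
  show "R_dg (u + v) = R_dg u + R_dg v"
    by transfer (simp add: pderiv_add R_rel_refl)
  show mult: "R_dg (u * v) = u * R_dg v + v * R_dg u" for u v :: "'k R"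
    by transfer (simp add: pderiv_mult R_rel_refl)
  have "R_dg (R_const c) = 0"
    by transfer (simp add: R_rel_refl pderiv_pCons)
  then show "R_dg (R_const c * u) = R_const c * R_dg u"
    by (simp add: mult)
qed

lemma R_dx_dg_gens:
  "R_dx (R_x :: 'k::field R) = 1" "R_dx (R_g :: 'k R) = 0"
  "R_dg (R_x :: 'k R) = 0" "R_dg (R_g :: 'k R) = 1"
  by (transfer; simp add: map_poly_pCons map_poly_pderiv_1 pderiv_pCons R_rel_refl flip: one_pCons)+

lemma k_derivation_const: "D (R_const c) = 0" if "k_derivation D"
proof -
  have "D (1 * 1) = 1 * D 1 + 1 * D 1"
    using that unfolding k_derivation_def by blast
  then have "D 1 = 0"
    by simp
  then show ?thesis
    using that unfolding k_derivation_def by (metis mult.right_neutral mult_zero_right)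
qed

lemma R_induct_gens:
  fixes P :: "'k::field R \<Rightarrow> bool"
  assumes c: "\<And>c. P (R_const c)" and x: "P R_x" and g: "P R_g"
    and add: "\<And>u v. P u \<Longrightarrow> P v \<Longrightarrow> P (u + v)" and mult: "\<And>u v. P u \<Longrightarrow> P v \<Longrightarrow> P (u * v)"
  shows "P u"
proof -
  have coeff: "P (abs_R [:a:])" for a :: "'k poly"
  proof (induction a)
    case 0
    then show ?case using c[of 0] by (simp add: R_const.abs_eq)
  next
    case (pCons b a)
    have "abs_R [:pCons b a:] = R_const b + R_x * abs_R [:a:]"
      by (simp add: R_const.abs_eq R_x.abs_eq plus_R.abs_eq times_R.abs_eq)
    then show ?case using pCons c x by (auto intro: add mult)
  qed
  have "P (abs_R q)" for q :: "'k poly poly"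
  proof (induction q)
    case 0
    then show ?case using c[of 0] by (simp add: R_const.abs_eq)
  next
    case (pCons a q)
    have "abs_R (pCons a q) = abs_R [:a:] + R_g * abs_R q"
      by (simp add: R_g.abs_eq plus_R.abs_eq times_R.abs_eq)
    then show ?case using pCons coeff g by (auto intro: add mult)
  qed
  then show ?thesis
    by (induction u rule: R.abs_induct)
qed

text \<open>\<open>delta f\<close> is the unique \<open>k\<close>-linear derivation with \<open>x \<mapsto> f\<close> and \<open>g \<mapsto> x g\<close>.\<close>

lemma delta_unique:
  "D = delta f \<longleftrightarrow> k_derivation D \<and> D R_x = f \<and> D R_g = R_x * R_g"
proof -
  have delta: "k_derivation (delta f)"
    unfolding k_derivation_def delta_def
    by (simp add: R_dx_derivation[unfolded k_derivation_def]
        R_dg_derivation[unfolded k_derivation_def]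
        k_derivation_const[OF R_dx_derivation] k_derivation_const[OF R_dg_derivation]
        distrib_left mult.assoc mult.left_commute)
  have vals: "delta f R_x = f" "delta f R_g = R_x * R_g"
    by (simp_all add: delta_def R_dx_dg_gens)
  have "D = delta f" if D: "k_derivation D" "D R_x = f" "D R_g = R_x * R_g"
  proof
    fix u
    show "D u = delta f u"
    proof (induction u rule: R_induct_gens)
      case (1 c)
      then show ?case by (simp add: k_derivation_const D delta)
    next
      case (4 u v)
      then show ?case using D(1) delta unfolding k_derivation_def by metis
    next
      case (5 u v)
      then show ?case using D(1) delta unfolding k_derivation_def by metis
    qed (simp_all add: D vals)
  qed
  then show ?thesis
    using delta vals by blast
qed

end

theory Submission
  imports Defs
begin

text \<open>
  Write \<open>\<delta> ^ n (g) = P\<^sub>n g\<close>, where \<open>P\<^sub>0 = 1\<close> and \<open>P\<^sub>n\<^sub>+\<^sub>1 = \<delta> (P\<^sub>n) + x P\<^sub>n\<close>, and split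
  \<open>P\<^sub>n = \<Sum>\<^sub>j B\<^sub>n\<^sub>,\<^sub>j\<close> by degree in \<open>x, \<delta> x, \<delta>\<^sup>2 x, \<dots>\<close>; the \<open>B\<^sub>n\<^sub>,\<^sub>j\<close> are the partial Bell
  polynomials. They satisfy \<open>(j + 1) B\<^sub>n\<^sub>,\<^sub>j\<^sub>+\<^sub>1 = \<Sum>\<^sub>i (n choose i + 1) \<delta> ^ i (x) B\<^sub>n\<^sub>-\<^sub>1\<^sub>-\<^sub>i\<^sub>,\<^sub>j\<close>.
  For \<open>n = p\<close> all the binomial coefficients but the last vanish, so \<open>B\<^sub>p\<^sub>,\<^sub>1 = \<delta> ^ (p - 1) (x)\<close> and
  \<open>B\<^sub>p\<^sub>,\<^sub>j = 0\<close> for \<open>1 < j < p\<close>, because \<open>j\<close> is then invertible. As \<open>B\<^sub>p\<^sub>,\<^sub>0 = 0\<close> and \<open>B\<^sub>p\<^sub>,\<^sub>p = x ^ p\<close>,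
  only two terms of \<open>P\<^sub>p\<close> survive.
\<close>

locale ring_derivation =
  fixes d :: "'a::comm_ring_1 \<Rightarrow> 'a"
  assumes add: "d (u + v) = d u + d v"
    and mult: "d (u * v) = u * d v + v * d u"
begin

lemma zero [simp]: "d 0 = 0"
  using add[of 0 0] by simp

lemma one [simp]: "d 1 = 0"
  using mult[of 1 1] by simp

lemma of_nat [simp]: "d (of_nat n) = 0"
  by (induction n) (simp_all add: add)

lemma sum: "d (\<Sum>i\<in>A. h i) = (\<Sum>i\<in>A. d (h i))"
  by (induction A rule: infinite_finite_induct) (simp_all add: add)

fun bell :: "'a \<Rightarrow> nat \<Rightarrow> nat \<Rightarrow> 'a" where
  "bell x 0 0 = 1"
| "bell x 0 (Suc j) = 0"
| "bell x (Suc n) 0 = d (bell x n 0)"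
| "bell x (Suc n) (Suc j) = d (bell x n (Suc j)) + x * bell x n j"

lemma bell_0_right: "bell x n 0 = (if n = 0 then 1 else 0)"
proof (induction n)
  case (Suc n)
  then show ?case by (cases n) simp_all
qed simp

lemma bell_eq_0: "n < j \<Longrightarrow> bell x n j = 0"
proof (induction n arbitrary: j)
  case 0
  then show ?case by (cases j) simp_all
next
  case (Suc n)
  then show ?case by (cases j) simp_all
qed

lemma bell_self: "bell x n n = x ^ n"
  by (induction n) (simp_all add: bell_eq_0)

lemma funpow_eq_sum_bell:
  assumes "d g = x * g"
  shows "(d ^^ n) g = (\<Sum>j\<le>n. bell x n j) * g"
proof (induction n)
  case (Suc n)
  \<comment> \<open>The added summand \<open>j = Suc n\<close> is \<open>d 0 = 0\<close>; it lines
    the sums up with the recursion of \<open>bell\<close>.\<close>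
  have "d (\<Sum>j\<le>n. bell x n j) + x * (\<Sum>j\<le>n. bell x n j)
      = (\<Sum>j\<le>Suc n. d (bell x n j)) + (\<Sum>j\<le>n. x * bell x n j)"
    by (simp add: sum sum_distrib_left bell_eq_0)
  also have "\<dots> = (\<Sum>j\<le>Suc n. bell x (Suc n) j)"
    by (simp only: sum.atMost_Suc_shift bell.simps sum.distrib add.assoc)
  finally show ?case
    using Suc assms by (simp add: mult algebra_simps del: sum.atMost_Suc)
       (simp add: distrib_left[symmetric] mult.commute[of _ g] del: sum.atMost_Suc)
qed simp

text \<open>Induction on \<open>n\<close>: the product rule applied to the identity for
  \<open>n\<close> gives sums that Pascal's rule merges into those for \<open>Suc n\<close>.\<close>

lemma bell_rec:
  "of_nat (Suc j) * bell x n (Suc j)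
    = (\<Sum>i<n. of_nat (n choose Suc i) * (d ^^ i) x * bell x (n - Suc i) j)"
proof (induction n arbitrary: j)
  case 0
  then show ?case by simp
next
  case (Suc n)
  let ?c = "\<lambda>i. of_nat (n choose Suc i) :: 'a" and ?x = "\<lambda>i. (d ^^ i) x"
  \<comment> \<open>For \<open>j > 0\<close>, the induction hypothesis at \<open>j - 1\<close>,
    times \<open>x\<close>, completes each \<open>d (bell ...)\<close> to the next row.\<close>
  have drop: "x * (of_nat j * bell x n j) + (\<Sum>i<n. ?c i * ?x i * d (bell x (n - Suc i) j))
      = (\<Sum>i<n. ?c i * ?x i * bell x (Suc (n - Suc i)) j)"
  proof (cases j)
    case 0
    then show ?thesis by simp
  next
    case (Suc j')
    show ?thesis
      unfolding Suc Suc.IH sum_distrib_left sum.distrib[symmetric]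
      by (rule sum.cong) (simp_all add: algebra_simps)
  qed
  have "of_nat (Suc j) * bell x (Suc n) (Suc j)
      = d (of_nat (Suc j) * bell x n (Suc j)) + x * (of_nat j * bell x n j) + x * bell x n j"
    by (simp add: mult algebra_simps del: of_nat_Suc) (simp add: algebra_simps)
  also have "d (of_nat (Suc j) * bell x n (Suc j))
      = (\<Sum>i<n. ?c i * ?x (Suc i) * bell x (n - Suc i) j)
        + (\<Sum>i<n. ?c i * ?x i * d (bell x (n - Suc i) j))"
    unfolding Suc.IH sum sum.distrib[symmetric]
    by (rule sum.cong) (simp_all add: mult algebra_simps)
  also have "\<dots> + x * (of_nat j * bell x n j) + x * bell x n j
      = (x * bell x n j + (\<Sum>i<n. ?c i * ?x (Suc i) * bell x (n - Suc i) j))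
        + (\<Sum>i<n. ?c i * ?x i * bell x (Suc (n - Suc i)) j)"
    unfolding drop[symmetric] by (simp add: algebra_simps)
  also have "x * bell x n j + (\<Sum>i<n. ?c i * ?x (Suc i) * bell x (n - Suc i) j)
      = (\<Sum>i<Suc n. of_nat (n choose i) * ?x i * bell x (n - i) j)"
    by (simp add: sum.lessThan_Suc_shift del: sum.lessThan_Suc)
  also have "(\<Sum>i<n. ?c i * ?x i * bell x (Suc (n - Suc i)) j)
      = (\<Sum>i<Suc n. ?c i * ?x i * bell x (n - i) j)"
    by (simp add: Suc_diff_Suc binomial_eq_0)
  finally show ?case
    by (simp add: sum.distrib[symmetric] algebra_simps del: sum.lessThan_Suc)
qed

lemma bell_prime:
  assumes p: "prime p" and char: "of_nat p = (0 :: 'a)"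
  shows "of_nat (Suc j) * bell x p (Suc j) = (if j = 0 then (d ^^ (p - 1)) x else 0)"
proof -
  obtain q where q: "p = Suc q"
    using prime_gt_0_nat[OF p] gr0_conv_Suc by blast
  have "of_nat (p choose Suc i) = (0 :: 'a)" if "i < q" for i
  proof -
    have "p dvd p choose Suc i"
      using that p q by (intro dvd_choose_prime) auto
    then show ?thesis
      using char by (auto elim: dvdE)
  qed
  then have "of_nat (Suc j) * bell x p (Suc j) = (d ^^ q) x * bell x 0 j"
    unfolding bell_rec by (simp add: q del: binomial_Suc_Suc)
  then show ?thesis
    by (cases j) (simp_all add: q)
qed

lemma bell_prime_eq_0:
  assumes p: "prime p" and char: "of_nat p = (0 :: 'a)" and j: "1 < j" "j < p"
  shows "bell x p j = 0"
proof -
  have j0: "of_nat j * bell x p j = 0"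
    using bell_prime[OF p char, of "j - 1"] j(1) by simp
  have "coprime j p"
    using p j by (metis coprime_commute nat_dvd_not_less not_less_iff_gr_or_eq
        prime_imp_coprime zero_less_one less_trans)
  \<comment> \<open>By Bezout, \<open>a\<close> inverts \<open>j\<close> modulo \<open>p\<close>, so
    \<open>of_nat a\<close> cancels \<open>of_nat j\<close> in the ring.\<close>
  then obtain a b where "a * j = b * p + 1"
    using j(1) by (metis bezout_nat coprime_iff_gcd_eq_1 not_less_zero mult.commute)
  then have "of_nat (a * j) = (of_nat (b * p + 1) :: 'a)"
    by simp
  then have "bell x p j = of_nat a * (of_nat j * bell x p j)"
    by (simp add: char mult.assoc[symmetric])
  then show ?thesis
    by (simp add: j0)
qed

text \<open>The value at \<open>g\<close> of Hochschild's formula \<open>(\<delta> + x)\<^sup>p = \<delta>\<^sup>p + x\<^sup>p + \<delta>\<^sup>p\<^sup>-\<^sup>1(x)\<close>.\<close>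

lemma funpow_prime:
  assumes p: "prime p" and char: "of_nat p = (0 :: 'a)" and g: "d g = x * g"
  shows "(d ^^ p) g = (d ^^ (p - 1)) x * g + x ^ p * g"
proof -
  have "1 < p"
    using p by (rule prime_gt_1_nat)
  have "bell x p j = 0" if "j \<le> p" "j \<noteq> 1" "j \<noteq> p" for j
  proof (cases "j = 0")
    case True
    then show ?thesis using \<open>1 < p\<close> by (simp add: bell_0_right)
  next
    case False
    then show ?thesis using that by (intro bell_prime_eq_0[OF p char]) auto
  qed
  then have "(\<Sum>j\<le>p. bell x p j) = (\<Sum>j\<in>{1, p}. bell x p j)"
    using \<open>1 < p\<close> by (intro sum.mono_neutral_right) auto
  also have "\<dots> = (d ^^ (p - 1)) x + x ^ p"
    using bell_prime[OF p char, of 0] \<open>1 < p\<close> by (simp add: bell_self)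
  finally show ?thesis
    by (simp add: funpow_eq_sum_bell[OF g] distrib_right)
qed

end

text \<open>Carries the characteristic of \<open>'k\<close> over to \<open>'k R\<close>.\<close>

lemma of_nat_R: "of_nat n = R_const (of_nat n :: 'k::field)"
proof (induction n)
  case 0
  have "R_const (0 :: 'k) = 0"
    by transfer (simp add: R_rel_refl)
  then show ?case
    by simp
next
  case (Suc n)
  have "R_const (1 + of_nat n :: 'k) = 1 + R_const (of_nat n)"
    by transfer (simp add: R_rel_refl one_pCons)
  then show ?case
    using Suc by simp
qed

theorem proposition3p4:
  fixes p :: nat and f :: "'k::alg_closed_field R"
  assumes "prime p" and "odd p" and "CHAR('k) = p"
  shows "(delta f ^^ p) R_g = (delta f ^^ (p - 2)) f * R_g + R_x ^ p * R_g
       \<and> (delta f ^^ (p - 2)) f * R_g + R_x ^ p * R_g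
           = (delta f ^^ (p - 1)) R_x * R_g + R_x ^ p * R_g"
proof -
  have delta: "k_derivation (delta f)" "delta f R_x = f" "delta f R_g = R_x * R_g"
    using delta_unique[of "delta f" f] by simp_all
  interpret ring_derivation "delta f"
    using delta(1) unfolding k_derivation_def by unfold_locales auto
  have "of_nat p = (0 :: 'k R)"
    using assms(3) of_nat_R[of p, where 'k = 'k] of_nat_R[of 0, where 'k = 'k] by auto
  then have "(delta f ^^ p) R_g = (delta f ^^ (p - 1)) R_x * R_g + R_x ^ p * R_g"
    using assms(1) delta(3) by (intro funpow_prime)
  moreover have "p - 1 = Suc (p - 2)"
    using prime_gt_1_nat[OF assms(1)] by simp
  then have "(delta f ^^ (p - 1)) R_x = (delta f ^^ (p - 2)) f"
    by (simp add: funpow_Suc_right delta(2) del: funpow.simps)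
  ultimately show ?thesis
    by simp
qed

end
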